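(* Let $\nu\ge0$ and $\alpha\in\{1,2\}$. There exists a (particular) solution of the equation $$\partial_tf_x=-\partial_tg-ff_{xx}+(f_x)^2+gf_x-\nu\Lambda^\alpha f_x,$$ on the one-dimensional torus, which blows up in finite time.
   Context: The torus is $[-\pi,\pi)$ with periodic boundary conditions imposed on $f_x$. Subscripts $x$ denote derivatives in $x$, $\Lambda^\alpha=(-\partial_x^2)^{\alpha/2}$ is the Fourier multiplier $|k|^\alpha$, and $g$ and $f$ are determined by $f_x$ through $$g(t)=\frac1\pi\int_0^t\|f_x(\tau)\|_{L^2(-\pi,\pi)}^2\,d\tau,\qquad f(x,t)=\int_{-\pi}^xf_x(x',t)\,dx'.$$ Blow-up in finite time means that there is $t_*\in(0,\infty)$ such that $f_x$ is a smooth solution on $[0,t_* )$ and $\|f_x(\cdot,t)\|_{L^\infty}$ is unbounded as $t\to t_*^-$. *)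

theory Defs
  imports "HOL-Analysis.Analysis" "HOL-Probability.Essential_Supremum"
begin

text \<open>
  Functions on the torus \<open>[-\<pi>, \<pi>)\<close> are represented by \<open>2\<pi>\<close>-periodic functions on the real
  line.  The unknown \<open>f\<^sub>x\<close> is a function \<open>u x t\<close> of space and time.
\<close>

text \<open>
  \<open>C\<^sup>k\<close> regularity of functions on a set \<open>S\<close>, with derivatives relative to \<open>S\<close>; it is only used
  for \<open>S = \<real> \<times> [0,T)\<close>, where derivatives within \<open>S\<close> are unique (and one-sided in time at
  \<open>t = 0\<close>).
\<close>

primrec Ck_on :: "nat \<Rightarrow> ('a::real_normed_vector \<Rightarrow> 'b::real_normed_vector) \<Rightarrow> 'a set \<Rightarrow> bool" where
  "Ck_on 0 h S \<longleftrightarrow> continuous_on S h"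
| "Ck_on (Suc k) h S \<longleftrightarrow>
     (\<exists>h'. (\<forall>p\<in>S. (h has_derivative h' p) (at p within S)) \<and> (\<forall>v. Ck_on k (\<lambda>p. h' p v) S))"

definition smooth_on :: "('a::real_normed_vector \<Rightarrow> 'b::real_normed_vector) \<Rightarrow> 'a set \<Rightarrow> bool" where
  "smooth_on h S \<longleftrightarrow> (\<forall>k. Ck_on k h S)"

definition torus_L2_norm :: "(real \<Rightarrow> real) \<Rightarrow> real" where
  "torus_L2_norm v = sqrt (integral {-pi..pi} (\<lambda>x. (v x)\<^sup>2))"

definition torus_Linf_norm :: "(real \<Rightarrow> real) \<Rightarrow> ereal" where
  "torus_Linf_norm v = esssup (restrict_space lborel {-pi..<pi}) (\<lambda>x. ereal \<bar>v x\<bar>)"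

definition fourier_coeff :: "(real \<Rightarrow> real) \<Rightarrow> int \<Rightarrow> complex" where
  "fourier_coeff v k =
     integral {-pi..pi} (\<lambda>x. complex_of_real (v x) * exp (- \<i> * of_int k * of_real x)) / of_real (2 * pi)"

text \<open>
  The Fourier multiplier \<open>|k|\<^sup>\<alpha>\<close> (for \<open>\<alpha> > 0\<close>, as \<open>0 powr \<alpha> = 0\<close>).  For smooth periodic \<open>v\<close> the
  series converges absolutely, and its sum is real since \<open>v\<close> is.
\<close>

definition Lambda :: "real \<Rightarrow> (real \<Rightarrow> real) \<Rightarrow> real \<Rightarrow> real" where
  "Lambda \<alpha> v x =
     Re (\<Sum>\<^sub>\<infinity>k::int. of_real (\<bar>real_of_int k\<bar> powr \<alpha>) * fourier_coeff v k * exp (\<i> * of_int k * of_real x))"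

definition g_of :: "(real \<Rightarrow> real \<Rightarrow> real) \<Rightarrow> real \<Rightarrow> real" where
  "g_of u t = 1 / pi * integral {0..t} (\<lambda>\<tau>. (torus_L2_norm (\<lambda>x. u x \<tau>))\<^sup>2)"

definition f_of :: "(real \<Rightarrow> real \<Rightarrow> real) \<Rightarrow> real \<Rightarrow> real \<Rightarrow> real" where
  "f_of u x t = integral {-pi..x} (\<lambda>y. u y t)"

text \<open>
  Smooth solutions on \<open>[0,T)\<close>.  The condition \<open>f(\<pi>,t) = f(-\<pi>,t)\<close> (that is, \<open>f\<^sub>x\<close> has zero mean)
  says that \<open>f\<close> itself is a function on the torus.  It excludes spatially constant \<open>f\<^sub>x\<close>, which
  do not come from a periodic \<open>f\<close> but for which the equation reduces to the ordinary
  differential equation \<open>c' = - c\<^sup>2 + g c\<close>.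
\<close>

definition smooth_torus_solution ::
  "real \<Rightarrow> real \<Rightarrow> real \<Rightarrow> (real \<Rightarrow> real \<Rightarrow> real) \<Rightarrow> bool" where
  "smooth_torus_solution \<nu> \<alpha> T u \<longleftrightarrow>
     smooth_on (\<lambda>(x, t). u x t) (UNIV \<times> {0..<T}) \<and>
     (\<forall>t\<in>{0..<T}. \<forall>x. u (x + 2 * pi) t = u x t) \<and>
     (\<forall>t\<in>{0..<T}. f_of u pi t = f_of u (-pi) t) \<and>
     (\<forall>t\<in>{0..<T}. \<exists>g'. (g_of u has_real_derivative g') (at t within {0..<T}) \<and>
        (\<forall>x\<in>{-pi..<pi}.
          ((\<lambda>s. u x s) has_real_derivative
             (- g' - f_of u x t * deriv (\<lambda>y. u y t) x + (u x t)\<^sup>2 + g_of u t * u x t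
              - \<nu> * Lambda \<alpha> (\<lambda>y. u y t) x)) (at t within {0..<T})))"

definition blows_up_at :: "real \<Rightarrow> (real \<Rightarrow> real \<Rightarrow> real) \<Rightarrow> bool" where
  "blows_up_at T u \<longleftrightarrow> (\<forall>M::real. \<exists>\<^sub>F t in at_left T. ereal M < torus_Linf_norm (\<lambda>x. u x t))"

end

theory Submission
  imports Defs
begin

text \<open>
  The equation has an explicit blowing-up solution made of a single Fourier mode.  For
  \<open>f\<^sub>x = A(t) cos x\<close> one has \<open>f = A sin x\<close>, so that
  \<open>- f f\<^sub>x\<^sub>x + (f\<^sub>x)\<^sup>2 = A\<^sup>2 (sin\<^sup>2 x + cos\<^sup>2 x) = A\<^sup>2\<close> is constant in space, and it is cancelled exactly by
  \<open>g' = \<parallel>f\<^sub>x\<parallel>\<^sup>2 / \<pi> = A\<^sup>2\<close>.  As \<open>cos\<close> only involves the wave numbers \<open>\<plusminus>1\<close>, it is fixed by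
  \<open>\<Lambda>\<^sup>\<alpha>\<close>.  The equation thus collapses to the system
  \<open>A' = (g - \<nu>) A\<close>, \<open>g' = A\<^sup>2\<close>, \<open>g(0) = 0\<close>.

  Along this system \<open>A\<^sup>2 - (g - \<nu>)\<^sup>2\<close> is conserved.  Choosing \<open>A(0)\<close> so that the conserved value
  is 1 turns the second equation into \<open>(g - \<nu>)' = 1 + (g - \<nu>)\<^sup>2\<close>, whence
  \<open>g(t) = \<nu> + tan (t - \<phi>)\<close> and \<open>A(t) = 1 / cos (t - \<phi>)\<close> with \<open>\<phi> = arctan \<nu>\<close>.  Dissipation only
  delays the blow-up, to the time \<open>T = \<pi>/2 + arctan \<nu>\<close>.

  What remains is to evaluate the multiplier and the norms on multiples of the cosine
  (\<open>Lambda_cos\<close>, \<open>torus_L2_norm_cos\<close>, \<open>torus_Linf_norm_cos\<close>), and to show joint smoothness in \<open>(x, t)\<close> (\<open>trig_rational_Ck_on\<close>).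
\<close>

section \<open>Smoothness of trigonometric-rational functions\<close>

text \<open>
  Proving \<open>C\<^sup>k\<close> regularity by induction on \<open>k\<close> needs a class of functions that contains its own
  directional derivatives.  The class below is generated syntactically so that this closure
  follows from the product, quotient and chain rules; inverses are restricted to functions
  without zeros on \<open>S\<close>.
\<close>

inductive trig_rational :: "'a::real_normed_vector set \<Rightarrow> ('a \<Rightarrow> real) \<Rightarrow> bool" for S where
  const: "trig_rational S (\<lambda>_. c)"
| linear: "bounded_linear l \<Longrightarrow> trig_rational S l"
| add: "trig_rational S h \<Longrightarrow> trig_rational S k \<Longrightarrow> trig_rational S (\<lambda>p. h p + k p)"
| mult: "trig_rational S h \<Longrightarrow> trig_rational S k \<Longrightarrow> trig_rational S (\<lambda>p. h p * k p)"
| inverse: "trig_rational S h \<Longrightarrow> (\<And>p. p \<in> S \<Longrightarrow> h p \<noteq> 0) \<Longrightarrow> trig_rational S (\<lambda>p. inverse (h p))"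
| cos: "trig_rational S h \<Longrightarrow> trig_rational S (\<lambda>p. cos (h p))"
| sin: "trig_rational S h \<Longrightarrow> trig_rational S (\<lambda>p. sin (h p))"

lemma trig_rational_has_derivative:
  assumes "trig_rational S h"
  shows "\<exists>h'. (\<forall>p\<in>S. (h has_derivative h' p) (at p within S)) \<and> (\<forall>v. trig_rational S (\<lambda>p. h' p v))"
  using assms
proof induction
  case (const c)
  show ?case
    by (rule exI[of _ "\<lambda>_ _. 0"]) (auto intro: trig_rational.const)
next
  case (linear l)
  then show ?case
    by (intro exI[of _ "\<lambda>_. l"])
      (auto intro: trig_rational.const bounded_linear_imp_has_derivative)
next
  case (add h k)
  then obtain h' k' where
    "\<forall>p\<in>S. (h has_derivative h' p) (at p within S)" "\<forall>v. trig_rational S (\<lambda>p. h' p v)"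
    "\<forall>p\<in>S. (k has_derivative k' p) (at p within S)" "\<forall>v. trig_rational S (\<lambda>p. k' p v)"
    by blast
  then show ?case
    by (intro exI[of _ "\<lambda>p v. h' p v + k' p v"])
      (auto intro: trig_rational.add has_derivative_add)
next
  case (mult h k)
  then obtain h' k' where
    "\<forall>p\<in>S. (h has_derivative h' p) (at p within S)" "\<forall>v. trig_rational S (\<lambda>p. h' p v)"
    "\<forall>p\<in>S. (k has_derivative k' p) (at p within S)" "\<forall>v. trig_rational S (\<lambda>p. k' p v)"
    by blast
  with mult.hyps show ?case
    by (intro exI[of _ "\<lambda>p v. h p * k' p v + h' p v * k p"])
      (auto intro!: trig_rational.add trig_rational.mult[of S h] trig_rational.mult[of S _ k]
        has_derivative_mult)
next
  case (inverse h)
  then obtain h' where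
    h': "\<forall>p\<in>S. (h has_derivative h' p) (at p within S)" "\<forall>v. trig_rational S (\<lambda>p. h' p v)"
    by blast
  have "\<forall>p\<in>S. ((\<lambda>p. inverse (h p)) has_derivative
      (\<lambda>v. (-1) * (inverse (h p) * h' p v * inverse (h p)))) (at p within S)"
    using h'(1) inverse.hyps by (auto intro!: derivative_eq_intros)
  moreover have "trig_rational S (\<lambda>p. (-1) * (inverse (h p) * h' p v * inverse (h p)))" for v
    using h'(2) inverse.hyps
    by (intro trig_rational.mult trig_rational.const trig_rational.inverse) auto
  ultimately show ?case
    by (intro exI[of _ "\<lambda>p v. (-1) * (inverse (h p) * h' p v * inverse (h p))"]) auto
next
  case (cos h)
  then obtain h' where
    h': "\<forall>p\<in>S. (h has_derivative h' p) (at p within S)" "\<forall>v. trig_rational S (\<lambda>p. h' p v)"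
    by blast
  have "\<forall>p\<in>S. ((\<lambda>p. cos (h p)) has_derivative
      (\<lambda>v. (-1) * (sin (h p) * h' p v))) (at p within S)"
    using h'(1) by (auto intro!: derivative_eq_intros)
  moreover have "trig_rational S (\<lambda>p. (-1) * (sin (h p) * h' p v))" for v
    using h'(2) cos.hyps
    by (intro trig_rational.mult trig_rational.const trig_rational.sin) auto
  ultimately show ?case
    by (intro exI[of _ "\<lambda>p v. (-1) * (sin (h p) * h' p v)"]) auto
next
  case (sin h)
  then obtain h' where
    h': "\<forall>p\<in>S. (h has_derivative h' p) (at p within S)" "\<forall>v. trig_rational S (\<lambda>p. h' p v)"
    by blast
  have "\<forall>p\<in>S. ((\<lambda>p. sin (h p)) has_derivative
      (\<lambda>v. cos (h p) * h' p v)) (at p within S)"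
    using h'(1) by (auto intro!: derivative_eq_intros)
  moreover have "trig_rational S (\<lambda>p. cos (h p) * h' p v)" for v
    using h'(2) sin.hyps
    by (intro trig_rational.mult trig_rational.cos) auto
  ultimately show ?case
    by (intro exI[of _ "\<lambda>p v. cos (h p) * h' p v"]) auto
qed

lemma trig_rational_Ck_on: "trig_rational S h \<Longrightarrow> Ck_on k h S"
proof (induction k arbitrary: h)
  case 0
  then show ?case
    using trig_rational_has_derivative[OF 0]
    by (auto simp: continuous_on_eq_continuous_within intro: has_derivative_continuous)
next
  case (Suc k)
  then show ?case
    using trig_rational_has_derivative[OF Suc.prems] by fastforce
qed

section \<open>The Fourier multiplier and the norms on multiples of the cosine\<close>

lemma fourier_mode_integral:
  fixes m :: int
  shows "((\<lambda>x::real. exp (\<i> * of_int m * of_real x)) has_integral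
           (if m = 0 then of_real (2 * pi) else 0)) {-pi..pi}"
proof (cases "m = 0")
  case True
  then show ?thesis
    using has_integral_const_real[of "1::complex" "-pi" pi] by (simp add: scaleR_conv_of_real)
next
  case False
  let ?F = "\<lambda>x::real. exp (\<i> * of_int m * of_real x) / (\<i> * of_int m)"
  have "((\<lambda>x::real. exp (\<i> * of_int m * of_real x)) has_integral (?F pi - ?F (-pi))) {-pi..pi}"
  proof (rule fundamental_theorem_of_calculus)
    fix x :: real
    have "((\<lambda>z. exp (\<i> * of_int m * z) / (\<i> * of_int m)) has_field_derivative
        exp (\<i> * of_int m * of_real x)) (at (of_real x))"
      using False by (auto intro!: derivative_eq_intros)
    then show "(?F has_vector_derivative exp (\<i> * of_int m * of_real x)) (at x within {-pi..pi})"
      by (rule has_vector_derivative_real_field)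
  qed simp
  moreover have "exp (\<i> * of_int m * of_real pi) = exp (\<i> * of_int m * of_real (-pi))"
    by (subst exp_eq) (rule exI[of _ m], simp add: algebra_simps)
  ultimately show ?thesis
    using False by simp
qed

lemma fourier_coeff_cos:
  "fourier_coeff (\<lambda>y. c * cos y) k = (if k = 1 \<or> k = -1 then of_real (c / 2) else 0)"
proof -
  have "complex_of_real (c * cos x) * exp (- \<i> * of_int k * of_real x) =
      of_real (c / 2) * (exp (\<i> * of_int (1 - k) * of_real x) + exp (\<i> * of_int (-1 - k) * of_real x))"
    for x :: real
    by (simp add: cos_of_real[symmetric] cos_exp_eq exp_add[symmetric] algebra_simps)
  moreover have "((\<lambda>x. of_real (c / 2) * (exp (\<i> * of_int (1 - k) * complex_of_real x) +
      exp (\<i> * of_int (-1 - k) * of_real x))) has_integral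
      of_real (c / 2) * ((if 1 - k = 0 then of_real (2 * pi) else 0) +
         (if -1 - k = 0 then of_real (2 * pi) else 0))) {-pi..pi}"
    by (intro has_integral_mult_right has_integral_add fourier_mode_integral)
  ultimately have "((\<lambda>x. complex_of_real (c * cos x) * exp (- \<i> * of_int k * of_real x)) has_integral
      of_real (c / 2) * ((if 1 - k = 0 then of_real (2 * pi) else 0) +
         (if -1 - k = 0 then of_real (2 * pi) else 0))) {-pi..pi}"
    by (simp only:)
  then show ?thesis
    unfolding fourier_coeff_def by (auto dest!: integral_unique)
qed

text \<open>The only wave numbers present are \<open>\<plusminus>1\<close>, where \<open>\<bar>k\<bar>\<^sup>\<alpha> = 1\<close>.\<close>

lemma Lambda_cos: "Lambda \<alpha> (\<lambda>y. c * cos y) x = c * cos x"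
proof -
  let ?s = "\<lambda>k::int. of_real (\<bar>real_of_int k\<bar> powr \<alpha>) * fourier_coeff (\<lambda>y. c * cos y) k *
     exp (\<i> * of_int k * of_real x)"
  have "infsum ?s UNIV = infsum ?s {1, -1}"
    by (rule infsum_cong_neutral) (auto simp: fourier_coeff_cos)
  also have "\<dots> = of_real c * ((exp (\<i> * of_real x) + exp (- (\<i> * of_real x))) / 2)"
    by (simp add: fourier_coeff_cos algebra_simps add_divide_distrib)
  also have "\<dots> = of_real (c * cos x)"
    by (simp add: cos_exp_eq cos_of_real[symmetric])
  finally show ?thesis
    unfolding Lambda_def by simp
qed

lemma torus_L2_norm_cos: "(torus_L2_norm (\<lambda>x. c * cos x))\<^sup>2 = pi * c\<^sup>2"
proof -
  let ?F = "\<lambda>x::real. (x + sin x * cos x) / 2"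
  have "((\<lambda>x. (cos x)\<^sup>2) has_integral (?F pi - ?F (-pi))) {-pi..pi}"
  proof (rule fundamental_theorem_of_calculus)
    fix x :: real
    have "(?F has_real_derivative (cos x)\<^sup>2) (at x within {-pi..pi})"
      by (auto intro!: derivative_eq_intros simp: sin_squared_eq power2_eq_square[symmetric])
    then show "(?F has_vector_derivative (cos x)\<^sup>2) (at x within {-pi..pi})"
      by (simp add: has_real_derivative_iff_has_vector_derivative)
  qed simp
  then have "((\<lambda>x. c\<^sup>2 * (cos x)\<^sup>2) has_integral (c\<^sup>2 * pi)) {-pi..pi}"
    by (intro has_integral_mult_right) simp
  then have "integral {-pi..pi} (\<lambda>x. (c * cos x)\<^sup>2) = pi * c\<^sup>2"
    unfolding power_mult_distrib by (simp only: integral_unique mult.commute)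
  then show ?thesis
    by (simp add: torus_L2_norm_def)
qed

text \<open>
  The factor \<open>1/2\<close> leaves room for an interval of positive measure, \<open>[0, \<pi>/3]\<close>, on which the
  cosine is at least \<open>1/2\<close>; a bound up to a constant suffices to detect blow-up.
\<close>

lemma torus_Linf_norm_cos: "ereal (\<bar>c\<bar> / 2) \<le> torus_Linf_norm (\<lambda>x. c * cos x)"
proof (rule ccontr)
  let ?M = "restrict_space lborel {-pi..<pi}"
  assume "\<not> ?thesis"
  then have less: "torus_Linf_norm (\<lambda>x. c * cos x) < ereal (\<bar>c\<bar> / 2)"
    by simp
  have "AE x in ?M. ereal \<bar>c * cos x\<bar> \<le> torus_Linf_norm (\<lambda>x. c * cos x)"
    unfolding torus_Linf_norm_def by (rule esssup_AE)
  then have "AE x in lborel. x \<in> {-pi..<pi} \<longrightarrow> \<bar>c * cos x\<bar> < \<bar>c\<bar> / 2"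
    using less
    by (subst (asm) AE_restrict_space_iff)
      (auto elim!: eventually_mono dest: le_less_trans[where z = "ereal (\<bar>c\<bar> / 2)"])
  moreover have "x \<in> {-pi..<pi} \<and> \<not> \<bar>c * cos x\<bar> < \<bar>c\<bar> / 2" if "x \<in> {0..pi/3}" for x
  proof -
    have "x \<in> {-pi..<pi}"
      using that pi_gt_zero unfolding atLeastAtMost_iff atLeastLessThan_iff by linarith
    have "cos (pi / 3) \<le> cos x"
      using that by (intro cos_monotone_0_pi_le) auto
    then have "\<bar>c\<bar> / 2 \<le> \<bar>c * cos x\<bar>"
      using mult_left_mono[of "1/2" "cos x" "\<bar>c\<bar>"] by (simp add: cos_60 abs_mult)
    then show ?thesis
      using \<open>x \<in> {-pi..<pi}\<close> by simp
  qed
  ultimately have "AE x in lborel. x \<notin> {0..pi/3}"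
    by (elim eventually_mono) blast
  then have "emeasure lborel {0..pi/3} = 0"
    by (subst (asm) AE_iff_measurable[where N = "{0..pi/3}"]) auto
  then show False
    by simp
qed

section \<open>The blowing-up solution\<close>

theorem mainTheorem11:
  fixes \<nu> \<alpha> :: real
  assumes "\<nu> \<ge> 0" and "\<alpha> \<in> {1, 2}"
  shows "\<exists>fx :: real \<Rightarrow> real \<Rightarrow> real. \<exists>T>0.
           smooth_torus_solution \<nu> \<alpha> T fx \<and> blows_up_at T fx"
proof -
  define \<phi> where "\<phi> = arctan \<nu>"
  define T where "T = pi / 2 + \<phi>"
  define A where "A = (\<lambda>t. inverse (cos (t - \<phi>)))"
  define u where "u = (\<lambda>x t. A t * cos x)"
  have \<phi>: "0 \<le> \<phi>" "\<phi> < pi / 2" "tan \<phi> = \<nu>"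
    using assms(1) arctan_ubound[of \<nu>] by (auto simp: \<phi>_def tan_arctan)
  have T: "T > 0"
    using \<phi> pi_gt_zero unfolding T_def by linarith
  have cos_pos: "cos (t - \<phi>) > 0" if "t \<in> {0..<T}" for t
    using that \<phi> by (intro cos_gt_zero_pi) (auto simp: T_def)

  have smooth: "smooth_on (\<lambda>(x, t). u x t) (UNIV \<times> {0..<T})"
  proof -
    have "trig_rational (UNIV \<times> {0..<T})
        (\<lambda>p. inverse (cos (snd p + - \<phi>)) * cos (fst p) :: real)"
      using cos_pos
      by (intro trig_rational.mult trig_rational.inverse trig_rational.cos trig_rational.add
          trig_rational.const trig_rational.linear bounded_linear_fst bounded_linear_snd)
        (force)
    then have "trig_rational (UNIV \<times> {0..<T}) (\<lambda>(x, t). u x t)"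
      by (simp add: u_def A_def case_prod_unfold)
    then show ?thesis
      unfolding smooth_on_def by (blast intro: trig_rational_Ck_on)
  qed

  have f: "f_of u x t = A t * sin x" if "-pi \<le> x" for x t
  proof -
    have "((\<lambda>y. A t * cos y) has_integral (A t * sin x - A t * sin (-pi))) {-pi..x}"
      using that
      by (intro fundamental_theorem_of_calculus)
        (auto intro!: derivative_eq_intros simp flip: has_real_derivative_iff_has_vector_derivative)
    then have "integral {-pi..x} (\<lambda>y. A t * cos y) = A t * sin x"
      by (simp only: integral_unique) simp
    then show ?thesis
      by (simp only: f_of_def u_def)
  qed

  have tan_deriv: "((\<lambda>s. tan (s - \<phi>) + \<nu>) has_real_derivative (A t)\<^sup>2) (at t within S)"
    if "t \<in> {0..<T}" for t S
    using cos_pos[OF that]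
    by (auto intro!: derivative_eq_intros simp: A_def power_inverse)
  have g: "g_of u t = tan (t - \<phi>) + \<nu>" if "t \<in> {0..<T}" for t
  proof -
    have "((\<lambda>s. (A s)\<^sup>2) has_integral ((tan (t - \<phi>) + \<nu>) - (tan (0 - \<phi>) + \<nu>))) {0..t}"
      using that tan_deriv
      by (intro fundamental_theorem_of_calculus)
        (auto simp flip: has_real_derivative_iff_has_vector_derivative)
    then have "integral {0..t} (\<lambda>s. (A s)\<^sup>2) = tan (t - \<phi>) + \<nu>"
      using \<phi>(3) by (simp add: integral_unique)
    then show ?thesis
      by (simp add: g_of_def u_def torus_L2_norm_cos)
  qed
  have g_deriv: "(g_of u has_real_derivative (A t)\<^sup>2) (at t within {0..<T})"
    if "t \<in> {0..<T}" for t
    by (rule has_field_derivative_transform_within[OF tan_deriv[OF that], of 1])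
      (use that g in auto)

  have A_deriv: "(A has_real_derivative tan (t - \<phi>) * A t) (at t within {0..<T})"
    if "t \<in> {0..<T}" for t
    using cos_pos[OF that] unfolding A_def
    by (auto intro!: derivative_eq_intros simp: tan_def field_simps)
  have u_x: "deriv (\<lambda>y. u y t) x = - A t * sin x" for x t
    unfolding u_def by (rule DERIV_imp_deriv) (auto intro!: derivative_eq_intros)
  have Lambda: "Lambda \<alpha> (\<lambda>y. u y t) x = u x t" for x t
    unfolding u_def by (rule Lambda_cos)

  have evol: "((\<lambda>s. u x s) has_real_derivative
      (- (A t)\<^sup>2 - f_of u x t * deriv (\<lambda>y. u y t) x + (u x t)\<^sup>2 + g_of u t * u x t
        - \<nu> * Lambda \<alpha> (\<lambda>y. u y t) x)) (at t within {0..<T})"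
    if "t \<in> {0..<T}" "x \<in> {-pi..<pi}" for x t
  proof -
    have x: "-pi \<le> x"
      using that(2) by simp
    have "- (A t)\<^sup>2 - f_of u x t * deriv (\<lambda>y. u y t) x + (u x t)\<^sup>2 + g_of u t * u x t
        - \<nu> * Lambda \<alpha> (\<lambda>y. u y t) x =
      (A t)\<^sup>2 * ((sin x)\<^sup>2 + (cos x)\<^sup>2 - 1) + tan (t - \<phi>) * A t * cos x"
      unfolding u_x Lambda f[OF x] g[OF that(1)] unfolding u_def by algebra
    \<comment> \<open>the nonlocal and the nonlinear terms cancel; only \<open>(g - \<nu>) f\<^sub>x\<close> survives\<close>
    also have "\<dots> = tan (t - \<phi>) * A t * cos x"
      by simp
    finally show ?thesis
      using DERIV_cmult_right[OF A_deriv[OF that(1)], of "cos x"]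
      by (simp only:) (simp add: u_def)
  qed

  have "smooth_torus_solution \<nu> \<alpha> T u"
    unfolding smooth_torus_solution_def
  proof (intro conjI ballI allI)
    fix t assume "t \<in> {0..<T}"
    then show "\<exists>g'. (g_of u has_real_derivative g') (at t within {0..<T}) \<and>
        (\<forall>x\<in>{-pi..<pi}. ((\<lambda>s. u x s) has_real_derivative
             (- g' - f_of u x t * deriv (\<lambda>y. u y t) x + (u x t)\<^sup>2 + g_of u t * u x t
              - \<nu> * Lambda \<alpha> (\<lambda>y. u y t) x)) (at t within {0..<T}))"
      using g_deriv evol by blast
  qed (use smooth f in \<open>auto simp: u_def\<close>)

  moreover have "blows_up_at T u"
    unfolding blows_up_at_def
  proof
    fix M :: real
    have pos: "\<forall>\<^sub>F t in at_left T. t \<in> {0<..<T}"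
      using T by (rule eventually_at_left_real)
    have "((\<lambda>t. cos (t - \<phi>)) \<longlongrightarrow> cos (T - \<phi>)) (at_left T)"
      by (intro tendsto_intros)
    then have "((\<lambda>t. cos (t - \<phi>)) \<longlongrightarrow> 0) (at_left T)"
      by (simp add: T_def)
    moreover have "\<forall>\<^sub>F t in at_left T. 0 < cos (t - \<phi>)"
      using pos by eventually_elim (auto intro: cos_pos)
    ultimately have "LIM t at_left T. A t :> at_top"
      unfolding A_def
      by (rule filterlim_inverse_at_top)
    then have "\<forall>\<^sub>F t in at_left T. 2 * \<bar>M\<bar> < A t"
      by (simp add: filterlim_at_top_dense)
    then have "\<forall>\<^sub>F t in at_left T. ereal M < torus_Linf_norm (\<lambda>x. u x t)"
    proof (rule eventually_mono)
      fix t assume "2 * \<bar>M\<bar> < A t"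
      then have "ereal M < ereal (\<bar>A t\<bar> / 2)"
        by simp
      also have "\<dots> \<le> torus_Linf_norm (\<lambda>x. u x t)"
        unfolding u_def by (rule torus_Linf_norm_cos)
      finally show "ereal M < torus_Linf_norm (\<lambda>x. u x t)" .
    qed
    then show "\<exists>\<^sub>F t in at_left T. ereal M < torus_Linf_norm (\<lambda>x. u x t)"
      by (rule eventually_frequently[OF trivial_limit_at_left_real])
  qed
  ultimately show ?thesis
    using T by blast
qed

end
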